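(* Let $\sigma$ and $\tau$ be types of an integer $n\ge 1$. The coefficient of $e^\otimes_\tau$ in the $e^\otimes$-expansion of $P_\sigma$ is $$(-1)^{\mathrm{area}(\tau)-\ell(\tau)}\sum_T \mathrm{wt}(T),$$ where the sum is over all constant wrapping block tabloids $T$ of shape $\sigma$ and content $\tau$.
   Context: **Types.** A composition is a finite (possibly empty) list $\beta$ of positive integers, with $\mathrm{area}(\beta)$ the sum of its entries and $\ell(\beta)$ its length. A partition is a weakly decreasing composition; $\mathrm{sort}(\beta)$ is the partition obtained by sorting $\beta$. An ordered type of $n$ is a sequence $\delta=(\delta|_1,\delta|_2,\ldots)$ of compositions with $\sum_i i\,\mathrm{area}(\delta|_i)=n$, written $\delta=1^{\delta|_1}2^{\delta|_2}\cdots$; $\ell(\delta)=\sum_i\ell(\delta|_i)$ and $\mathrm{area}(\delta)=\sum_i\mathrm{area}(\delta|_i)$. A type is an ordered type with all $\delta|_i$ partitions, and $\mathrm{psort}(\delta)$ is the type obtained by replacing each $\delta|_i$ by $\mathrm{sort}(\delta|_i)$. A block $d^r$ ($d,r\ge1$) is the ordered type with $\delta|_d=(r)$ and all other $\delta|_i$ empty. A type $\tau$ is identified with the multiset of its blocks (one copy of $d^r$ for each part $r$ of $\tau|_d$), and we list its blocks as $d_1^{r_1}d_2^{r_2}\cdots d_k^{r_k}$. **Polysymmetric functions.** Let $x_{ij}$ ($i,j\ge1$) be commuting indeterminates with $\deg x_{ij}=i$. $\mathrm{PSym}$ is the $\mathbb{Q}$-algebra of bounded-degree formal power series in the $x_{ij}$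 invariant under swapping $x_{ij}$ and $x_{ik}$ for all $i,j,k$; $\mathrm{PSym}(n)$ is its degree $n$ part. For an ordered type $\delta$, $e^\otimes_\delta=\prod_i e_{\delta|_i}(x_{i1},x_{i2},\ldots)$ where $e_\beta=\prod_j e_{\beta_j}$ is a product of elementary symmetric functions; $\{e^\otimes_\tau\}$ over types $\tau$ of $n$ is a basis of $\mathrm{PSym}(n)$, and the $e^\otimes$-expansion is the expansion in this basis. $P_d=\sum_{k\mid d}k\sum_{j\ge1}x_{kj}^{d/k}$; $P_{d^r}$ is obtained from $P_d$ by replacing each $x_{ij}$ by $x_{ij}^r$; and $P_\sigma=\prod_{i=1}^kP_{d_i^{r_i}}$ for $\sigma=d_1^{r_1}\cdots d_k^{r_k}$. **Wrappings.** View the block $d^r$ as an array of boxes with $d$ rows and $r$ columns. For $k\mid d$, divide the rows from top to bottom into $d/k$ "$k$-sheets" of $k$ consecutive rows. List all $dr/k$ columns of $k$-sheets (each having $k$ boxes) in reading order: the columns of the first sheet left to right, then of the second sheet left to right, and so on. For a composition $\beta=(\beta_1,\ldots,\beta_l)$ of $dr/k$, the $k$-wrapping of $d^r$ of content $\beta$ is the set partition $B=(B_1,\ldots,B_l)$ of the boxes in which $B_1$ consists of the first $\beta_1$ sheet-columns, $B_2$ of the next $\beta_2$, etc. Its ordered content is the ordered type $\mathrm{ocon}(B)=k^\beta$, and $\mathcal{L}(B)=|B_l|=k\beta_l$. A wrapping of $d^r$ is a $k$-wrapping for some $k\mid d$ (wrappings for different $k$ are regarded as different). **Constant wrapping block tabloids.**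 A constant wrapping block tabloid $T$ of shape $\sigma=d_1^{r_1}\cdots d_k^{r_k}$ and content $\tau$ is a list $(B^{(1)},\ldots,B^{(k)})$ where $B^{(i)}$ is a wrapping of $d_i^{r_i}$ and the multiset union of the blocks of $\mathrm{psort}(\mathrm{ocon}(B^{(i)}))$, $1\le i\le k$, equals $\tau$. Set $\mathrm{wt}(T)=\prod_{i=1}^k\mathcal{L}(B^{(i)})$. *)

theory Defs
  imports Complex_Main "HOL-Library.Multiset"
begin

text \<open>
  A monomial is the finite multiset of its variables, and (i, j) stands for x_ij. The indices 0 are
  not excluded from the type; every series defined below only involves variables with i, j \<ge> 1.
\<close>

type_synonym monom = "(nat \<times> nat) multiset"

typedef pseries = "UNIV :: (monom \<Rightarrow> rat) set"
  morphisms coeff Series ..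

lemma coeff_Series [simp]: "coeff (Series f) = f"
  by (simp add: Series_inverse)

lemma pseries_eqI: "(\<And>m. coeff f m = coeff g m) \<Longrightarrow> f = g"
  by (metis coeff_inject ext)

lemma finite_splits: "finite {(a, b). a + b = (m :: 'a multiset)}"
proof -
  have "finite {a. a \<subseteq># m}"
  proof (induction m)
    case (add x m)
    have "{a. a \<subseteq># add_mset x m} \<subseteq> {a. a \<subseteq># m} \<union> add_mset x ` {a. a \<subseteq># m}"
    proof
      fix a assume a: "a \<in> {a. a \<subseteq># add_mset x m}"
      show "a \<in> {a. a \<subseteq># m} \<union> add_mset x ` {a. a \<subseteq># m}"
      proof (cases "x \<in># a")
        case True
        then obtain b where "a = add_mset x b" by (auto dest: multi_member_split)
        with a show ?thesis by auto
      next
        case False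
        with a show ?thesis
          by (metis CollectD CollectI UnI1 diff_single_trivial subset_eq_diff_conv
              add_mset_add_single)
      qed
    qed
    then show ?case using add.IH by (meson finite_UnI finite_imageI finite_subset)
  qed simp
  moreover have "{(a, b). a + b = m} \<subseteq> {a. a \<subseteq># m} \<times> {a. a \<subseteq># m}" by auto
  ultimately show ?thesis by (meson finite_SigmaI finite_subset)
qed

instantiation pseries :: comm_ring_1
begin

definition zero_pseries :: pseries where "0 = Series (\<lambda>_. 0)"
definition one_pseries :: pseries where "1 = Series (\<lambda>m. if m = {#} then 1 else 0)"
definition plus_pseries :: "pseries \<Rightarrow> pseries \<Rightarrow> pseries"
  where "f + g = Series (\<lambda>m. coeff f m + coeff g m)"
definition minus_pseries :: "pseries \<Rightarrow> pseries \<Rightarrow> pseries"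
  where "f - g = Series (\<lambda>m. coeff f m - coeff g m)"
definition uminus_pseries :: "pseries \<Rightarrow> pseries"
  where "- f = Series (\<lambda>m. - coeff f m)"
definition times_pseries :: "pseries \<Rightarrow> pseries \<Rightarrow> pseries"
  where "f * g = Series (\<lambda>m. \<Sum>(a, b) | a + b = m. coeff f a * coeff g b)"

instance
proof
  fix f g h :: pseries
  show "f * g * h = f * (g * h)"
  proof (rule pseries_eqI)
    fix m
    have "coeff (f * g * h) m =
        (\<Sum>p | fst p + snd p = m. \<Sum>q | fst q + snd q = fst p.
           coeff f (fst q) * coeff g (snd q) * coeff h (snd p))"
      by (simp add: times_pseries_def case_prod_unfold sum_distrib_right)
    also have "\<dots> = (\<Sum>(p, q)\<in>(SIGMA p : {p. fst p + snd p = m}. {q. fst q + snd q = fst p}).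
           coeff f (fst q) * coeff g (snd q) * coeff h (snd p))"
      using finite_splits by (intro sum.Sigma) (auto simp: case_prod_unfold)
    also have "\<dots> = (\<Sum>(p, q)\<in>(SIGMA p : {p. fst p + snd p = m}. {q. fst q + snd q = snd p}).
           coeff f (fst p) * (coeff g (fst q) * coeff h (snd q)))"
      by (rule sum.reindex_bij_witness
            [where j = "\<lambda>(p, q). ((fst q, snd q + snd p), (snd q, snd p))"
              and i = "\<lambda>(p, q). ((fst p + fst q, snd q), (fst p, fst q))"])
         (auto simp: add.assoc mult.assoc)
    also have "\<dots> = (\<Sum>p | fst p + snd p = m. \<Sum>q | fst q + snd q = snd p.
           coeff f (fst p) * (coeff g (fst q) * coeff h (snd q)))"
      using finite_splits by (intro sum.Sigma [symmetric]) (auto simp: case_prod_unfold)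
    also have "\<dots> = coeff (f * (g * h)) m"
      by (simp add: times_pseries_def case_prod_unfold sum_distrib_left)
    finally show "coeff (f * g * h) m = coeff (f * (g * h)) m" .
  qed
  show "f * g = g * f"
  proof (rule pseries_eqI)
    fix m
    show "coeff (f * g) m = coeff (g * f) m"
      unfolding times_pseries_def coeff_Series
      by (rule sum.reindex_bij_witness [where i = prod.swap and j = prod.swap])
         (auto simp: add.commute mult.commute)
  qed
  show "1 * f = f"
  proof (rule pseries_eqI)
    fix m
    have "coeff (1 * f) m = (\<Sum>(a, b)\<in>{({#} :: monom, m)}. (if a = {#} then 1 else 0) * coeff f b)"
      unfolding times_pseries_def one_pseries_def coeff_Series
      by (intro sum.mono_neutral_right finite_splits) (auto split: if_splits)
    then show "coeff (1 * f) m = coeff f m" by simp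
  qed
  show "(f + g) * h = f * h + g * h"
    by (rule pseries_eqI)
       (simp add: times_pseries_def plus_pseries_def case_prod_unfold distrib_right sum.distrib)
  show "(0 :: pseries) \<noteq> 1"
    by (metis (mono_tags) coeff_Series one_pseries_def zero_neq_one zero_pseries_def)
qed (simp_all add: plus_pseries_def minus_pseries_def uminus_pseries_def zero_pseries_def
      coeff_inverse add_ac)

end

definition scale :: "rat \<Rightarrow> pseries \<Rightarrow> pseries" where
  "scale c f = Series (\<lambda>m. c * coeff f m)"

global_interpretation pseries: vector_space scale
  by standard (simp_all add: scale_def plus_pseries_def coeff_inverse algebra_simps)

definition var :: "nat \<Rightarrow> nat \<Rightarrow> pseries" where
  "var i j = Series (\<lambda>m. if m = {#(i, j)#} then 1 else 0)"

text \<open>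
  The sum of a possibly infinite family of series, for families in which every monomial occurs in
  only finitely many members.
\<close>

definition formal_sum :: "('a \<Rightarrow> pseries) \<Rightarrow> 'a set \<Rightarrow> pseries" where
  "formal_sum f A = Series (\<lambda>m. \<Sum>a | a \<in> A \<and> coeff (f a) m \<noteq> 0. coeff (f a) m)"

definition composition :: "nat list \<Rightarrow> bool" where
  "composition \<beta> \<longleftrightarrow> (\<forall>b\<in>set \<beta>. b > 0)"

definition is_partition :: "nat list \<Rightarrow> bool" where
  "is_partition \<beta> \<longleftrightarrow> composition \<beta> \<and> sorted_wrt (\<ge>) \<beta>"

text \<open>
  A sequence of compositions indexed by i \<ge> 1 is a function on all naturals that is empty at 0.
\<close>

type_synonym otype = "nat \<Rightarrow> nat list"

definition support :: "otype \<Rightarrow> nat set" where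
  "support \<delta> = {i. \<delta> i \<noteq> []}"

definition ordered_type :: "otype \<Rightarrow> bool" where
  "ordered_type \<delta> \<longleftrightarrow> \<delta> 0 = [] \<and> finite (support \<delta>) \<and> (\<forall>i. composition (\<delta> i))"

definition is_type :: "otype \<Rightarrow> bool" where
  "is_type \<delta> \<longleftrightarrow> ordered_type \<delta> \<and> (\<forall>i. is_partition (\<delta> i))"

definition weight :: "otype \<Rightarrow> nat" where
  "weight \<delta> = (\<Sum>i\<in>support \<delta>. i * sum_list (\<delta> i))"

definition area :: "otype \<Rightarrow> nat" where
  "area \<delta> = (\<Sum>i\<in>support \<delta>. sum_list (\<delta> i))"

definition len :: "otype \<Rightarrow> nat" where
  "len \<delta> = (\<Sum>i\<in>support \<delta>. length (\<delta> i))"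

definition types_of :: "nat \<Rightarrow> otype set" where
  "types_of n = {\<tau>. is_type \<tau> \<and> weight \<tau> = n}"

definition psort :: "otype \<Rightarrow> otype" where
  "psort \<delta> = (\<lambda>i. rev (sort (\<delta> i)))"

text \<open>The pair (d, r) stands for the block with d rows and r columns.\<close>

definition blocks :: "otype \<Rightarrow> (nat \<times> nat) multiset" where
  "blocks \<tau> = (\<Sum>d\<in>support \<tau>. image_mset (Pair d) (mset (\<tau> d)))"

definition elem_sym :: "nat \<Rightarrow> nat \<Rightarrow> pseries" where
  "elem_sym i r = formal_sum (\<lambda>S. \<Prod>j\<in>S. var i j) {S. S \<subseteq> {1..} \<and> finite S \<and> card S = r}"

definition e_otimes :: "otype \<Rightarrow> pseries" where
  "e_otimes \<delta> = (\<Prod>i\<in>support \<delta>. \<Prod>r\<leftarrow>\<delta> i. elem_sym i r)"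

definition P_at :: "(nat \<Rightarrow> nat \<Rightarrow> pseries) \<Rightarrow> nat \<Rightarrow> pseries" where
  "P_at y d = (\<Sum>k | k dvd d. of_nat k * formal_sum (\<lambda>j. y k j ^ (d div k)) {1..})"

definition P_block :: "nat \<Rightarrow> nat \<Rightarrow> pseries" where
  "P_block d r = P_at (\<lambda>i j. var i j ^ r) d"

definition P_type :: "otype \<Rightarrow> pseries" where
  "P_type \<sigma> = (\<Prod>(d, r)\<in>#blocks \<sigma>. P_block d r)"

text \<open>
  The library's representation is constantly 0 for a family that is not linearly independent or does
  not span the given vector. It looks up the basis vector itself instead of its index, which is
  harmless since distinct types give distinct basis vectors.
\<close>

definition e_coeff :: "nat \<Rightarrow> pseries \<Rightarrow> otype \<Rightarrow> rat" where
  "e_coeff n f \<tau> = pseries.representation (e_otimes ` types_of n) f (e_otimes \<tau>)"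

text \<open>Boxes are pairs (row, column), both counted from 0.\<close>

type_synonym box = "nat \<times> nat"

definition sheet_columns :: "nat \<Rightarrow> nat \<Rightarrow> nat \<Rightarrow> box set list" where
  "sheet_columns k d r =
     concat (map (\<lambda>s. map (\<lambda>c. {s * k..<(s + 1) * k} \<times> {c}) [0..<r]) [0..<d div k])"

text \<open>
  The sheet height k is recorded because one and the same set partition may arise for different k;
  the content is determined by the sheet height and the parts.
\<close>

datatype wrapping = Wrapping (sheet: nat) (content: "nat list") (parts: "box set list")

definition wrap :: "nat \<Rightarrow> nat \<Rightarrow> nat \<Rightarrow> nat list \<Rightarrow> wrapping" where
  "wrap k d r \<beta> = Wrapping k \<beta>
     (map (\<lambda>j. \<Union> (set (take (\<beta> ! j) (drop (sum_list (take j \<beta>)) (sheet_columns k d r)))))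
       [0..<length \<beta>])"

definition wrappings :: "nat \<Rightarrow> nat \<Rightarrow> wrapping set" where
  "wrappings d r = {wrap k d r \<beta> |k \<beta>. k dvd d \<and> composition \<beta> \<and> sum_list \<beta> = d * r div k}"

definition ocon :: "wrapping \<Rightarrow> otype" where
  "ocon B = (\<lambda>i. if i = sheet B then content B else [])"

definition last_size :: "wrapping \<Rightarrow> nat" where
  "last_size B = card (last (parts B))"

definition tabloids :: "(nat \<times> nat) list \<Rightarrow> otype \<Rightarrow> wrapping list set" where
  "tabloids bs \<tau> = {T. list_all2 (\<lambda>B (d, r). B \<in> wrappings d r) T bs \<and>
     (\<Sum>B\<leftarrow>T. blocks (psort (ocon B))) = blocks \<tau>}"

definition wt :: "wrapping list \<Rightarrow> nat" where
  "wt T = (\<Prod>B\<leftarrow>T. last_size B)"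

end

theory Submission
  imports Defs "HOL-Computational_Algebra.Formal_Power_Series" "HOL-Library.Product_Lexorder"
begin

text \<open>
  Iterating Newton's identity expands a power sum p_m as the sum over the compositions \<beta> of m of
  the last part of \<beta> times the product of the (-1)^(r-1) e_r over the parts r of \<beta>. For
  m = d r / k in the variables of degree k, these compositions are the contents of the k-wrappings
  of d^r, and k times the last part is the size of the last part of the wrapping. Multiplying over
  the blocks of \<sigma> expands P_\<sigma> as a sum over all tabloids of shape \<sigma>, which is then grouped
  by content.

  Reading off coefficients requires linear independence of the e_\<tau>. Order monomials by the
  multiset order over the lexicographic order of the variables. Least monomials are multiplicative
  and occur with coefficient 1 in the e_\<tau>; that of e_\<tau> is the product of the
  x_i1 x_i2 ... x_ir over the blocks i^r of \<tau>, so it determines \<tau>.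
\<close>

section \<open>Power sums as sums over compositions\<close>

text \<open>With the sign absorbed, all terms of Newton's identity are positive.\<close>

definition signed_esym :: "('a \<Rightarrow> 'b :: comm_ring_1) \<Rightarrow> 'a set \<Rightarrow> nat \<Rightarrow> 'b" where
  "signed_esym x A i = (- 1) ^ (i + 1) * (\<Sum>S | S \<subseteq> A \<and> card S = i. \<Prod>a\<in>S. x a)"

text \<open>Choosing from each factor either 1 or -x_a X indexes the expansion by subsets. Degree i
  gives (-1)^i e_i, while \<open>signed_esym\<close> carries (-1)^(i+1); hence the minus
  sign.\<close>

lemma prod_one_minus_nth:
  fixes x :: "'a \<Rightarrow> 'b :: comm_ring_1"
  assumes "finite A"
  shows "fps_nth (\<Prod>a\<in>A. 1 - fps_const (x a) * fps_X) i = - signed_esym x A i"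
proof -
  have fin: "finite S" if "S \<in> Pow A" for S
    using that assms finite_subset by auto
  have eq: "(\<Prod>a\<in>A. 1 - fps_const (x a) * fps_X) =
      (\<Sum>S\<in>Pow A. fps_const (\<Prod>a\<in>S. - x a) * fps_X ^ card S)"
  proof -
    have "(\<Prod>a\<in>A. 1 - fps_const (x a) * fps_X) =
        (\<Prod>a\<in>A. fps_const (- x a) * fps_X + 1)"
      by (intro prod.cong) (auto simp flip: fps_const_neg)
    also have "\<dots> = (\<Sum>S\<in>Pow A. (\<Prod>a\<in>S. fps_const (- x a) * fps_X) * (\<Prod>a\<in>A - S. 1))"
      by (rule prod_add) fact
    also have "\<dots> = (\<Sum>S\<in>Pow A. fps_const (\<Prod>a\<in>S. - x a) * fps_X ^ card S)"
    proof (intro sum.cong refl)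
      fix S assume "S \<in> Pow A"
      have "(\<Prod>a\<in>S. fps_const (- x a)) = fps_const (\<Prod>a\<in>S. - x a)"
        using fin[OF \<open>S \<in> Pow A\<close>] by induction (auto simp flip: fps_const_neg)
      then show "(\<Prod>a\<in>S. fps_const (- x a) * fps_X) * (\<Prod>a\<in>A - S. 1) =
          fps_const (\<Prod>a\<in>S. - x a) * fps_X ^ card S"
        by (simp add: prod.distrib)
    qed
    finally show ?thesis .
  qed
  have "fps_nth (\<Prod>a\<in>A. 1 - fps_const (x a) * fps_X) i =
      (\<Sum>S\<in>Pow A. if card S = i then \<Prod>a\<in>S. - x a else 0)"
    unfolding eq fps_sum_nth by (intro sum.cong) (auto simp: fps_X_power_nth)
  also have "\<dots> = (\<Sum>S | S \<subseteq> A \<and> card S = i. \<Prod>a\<in>S. - x a)"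
    using assms by (simp add: sum.inter_filter Pow_def flip: sum.inter_filter)
  also have "\<dots> = (\<Sum>S | S \<subseteq> A \<and> card S = i. (- 1) ^ i * (\<Prod>a\<in>S. x a))"
    by (intro sum.cong) (auto simp: prod_uminus)
  finally show ?thesis
    by (simp add: signed_esym_def sum_distrib_left sum_negf)
qed

text \<open>For a factor 1 - x_a X, -X times its logarithmic derivative is x_a X + x_a^2 X^2 + ...,
  and these series add up over the factors. Multiplying through by \<open>E A\<close> avoids
  division.\<close>

lemma logarithmic_derivative:
  fixes x :: "'a \<Rightarrow> 'b :: comm_ring_1"
  assumes "finite A"
  defines "E \<equiv> \<lambda>A. \<Prod>a\<in>A. 1 - fps_const (x a) * fps_X"
  shows "- (fps_X * fps_deriv (E A)) =
    E A * (\<Sum>a\<in>A. Abs_fps (\<lambda>m. if m = 0 then 0 else x a ^ m))"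
  using assms(1)
proof induction
  case empty
  then show ?case by (simp add: E_def)
next
  case (insert a A)
  define c where "c = fps_const (x a) * fps_X"
  define g where "g = Abs_fps (\<lambda>m. if m = 0 then 0 else x a ^ m)"
  define P where "P = (\<Sum>a\<in>A. Abs_fps (\<lambda>m. if m = 0 then 0 else x a ^ m))"
  \<comment> \<open>The geometric series without constant term, g = c / (1 - c).\<close>
  have geom: "(1 - c) * g = c"
  proof (rule fps_ext)
    fix m
    have "fps_nth (c * g) m = (if m = 0 then 0 else x a * fps_nth g (m - 1))"
      by (simp add: c_def mult.assoc)
    then show "fps_nth ((1 - c) * g) m = fps_nth c m"
      by (cases m) (auto simp: left_diff_distrib g_def c_def)
  qed
  have E: "E (insert a A) = (1 - c) * E A"
    using insert by (simp add: E_def c_def)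
  have Xc: "fps_X * fps_deriv (1 - c) = - c"
    by (simp add: c_def mult.commute flip: fps_const_neg)
  have "- (fps_X * fps_deriv (E (insert a A))) =
      (1 - c) * (- (fps_X * fps_deriv (E A))) - (fps_X * fps_deriv (1 - c)) * E A"
    unfolding E fps_deriv_mult by (simp add: algebra_simps del: fps_deriv_sub)
  also have "\<dots> = (1 - c) * (E A * P) + ((1 - c) * g) * E A"
    using insert.IH unfolding geom Xc P_def by simp
  also have "\<dots> = E (insert a A) * (g + P)"
    by (simp add: E algebra_simps)
  finally show ?case
    using insert by (simp add: g_def P_def)
qed

text \<open>Compare coefficients of X^m in \<open>logarithmic_derivative\<close>: the derivative
  brings out the factor m, and the Cauchy product pairs elementary functions with power
  sums.\<close>

lemma newton_identity:
  fixes x :: "'a \<Rightarrow> 'b :: comm_ring_1"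
  assumes "finite A" "m \<ge> 1"
  shows "(\<Sum>a\<in>A. x a ^ m) =
    of_nat m * signed_esym x A m + (\<Sum>i = 1..<m. signed_esym x A i * (\<Sum>a\<in>A. x a ^ (m - i)))"
proof -
  let ?E = "\<Prod>a\<in>A. 1 - fps_const (x a) * fps_X"
  define P where "P = (\<Sum>a\<in>A. Abs_fps (\<lambda>m. if m = 0 then 0 else x a ^ m))"
  have P: "fps_nth P m = (if m = 0 then 0 else \<Sum>a\<in>A. x a ^ m)" for m
    by (simp add: P_def fps_sum_nth)
  have e0: "signed_esym x A 0 = - 1"
  proof -
    have "{S. S \<subseteq> A \<and> card S = 0} = {{}}"
      using assms(1) by (auto dest: finite_subset)
    then show ?thesis by (simp add: signed_esym_def)
  qed
  have "of_nat m * signed_esym x A m = fps_nth (- (fps_X * fps_deriv ?E)) m"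
    using assms by (simp add: prod_one_minus_nth)
  also have "\<dots> = fps_nth (?E * P) m"
    unfolding P_def by (subst logarithmic_derivative) (use assms in auto)
  also have "\<dots> = (\<Sum>i = 0..m. - signed_esym x A i * fps_nth P (m - i))"
    by (simp add: fps_mult_nth prod_one_minus_nth assms)
  \<comment> \<open>The end terms are special: i = 0 gives the power sum itself because
    \<open>signed_esym x A 0\<close> is -1, and i = m gives 0 because \<open>P\<close> has no
    constant term.\<close>
  also have "{0..m} = insert 0 (insert m {1..<m})"
    using assms by auto
  also have "(\<Sum>i\<in>\<dots>. - signed_esym x A i * fps_nth P (m - i)) =
      fps_nth P m + (\<Sum>i = 1..<m. - signed_esym x A i * fps_nth P (m - i))"
    using assms by (simp add: e0 P)
  also have "(\<Sum>i = 1..<m. - signed_esym x A i * fps_nth P (m - i)) =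
      - (\<Sum>i = 1..<m. signed_esym x A i * (\<Sum>a\<in>A. x a ^ (m - i)))"
    by (simp add: P sum_negf)
  finally show ?thesis
    using assms by (simp add: P algebra_simps)
qed

section \<open>Compositions and the closed solution of Newton's recursion\<close>

definition compositions :: "nat \<Rightarrow> nat list set" where
  "compositions m = {\<beta>. composition \<beta> \<and> sum_list \<beta> = m}"

lemma finite_compositions: "finite (compositions m)"
proof (rule finite_subset)
  have "length \<beta> \<le> sum_list \<beta> \<and> set \<beta> \<subseteq> {..sum_list \<beta>}" if "composition \<beta>" for \<beta>
    using that by (induction \<beta>) (auto simp: composition_def)
  then show "compositions m \<subseteq> {\<beta>. set \<beta> \<subseteq> {..m} \<and> length \<beta> \<le> m}"
    by (auto simp: compositions_def)
qed (simp add: finite_lists_length_le)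

lemma compositions_rec:
  assumes "m \<ge> 1"
  shows "compositions m = insert [m] (\<Union>i\<in>{1..<m}. (#) i ` compositions (m - i))"
proof (intro equalityI subsetI)
  fix \<beta> assume \<beta>: "\<beta> \<in> compositions m"
  then obtain i \<gamma> where [simp]: "\<beta> = i # \<gamma>"
    using assms by (cases \<beta>) (auto simp: compositions_def)
  show "\<beta> \<in> insert [m] (\<Union>i\<in>{1..<m}. (#) i ` compositions (m - i))"
  proof (cases "\<gamma> = []")
    case False
    then have "sum_list \<gamma> > 0"
      using \<beta> by (cases \<gamma>) (auto simp: compositions_def composition_def)
    then have "i \<in> {1..<m}" "\<gamma> \<in> compositions (m - i)"
      using \<beta> by (auto simp: compositions_def composition_def)
    then show ?thesis by auto
  qed (use \<beta> in \<open>auto simp: compositions_def\<close>)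
qed (use assms in \<open>auto simp: compositions_def composition_def\<close>)

text \<open>The term m e_m is the one-part composition, and e_i p_(m-i) yields the compositions
  starting with i. With \<open>p\<close> and \<open>e\<close> abstract, the result applies to series
  in infinitely many variables.\<close>

lemma newton_solution:
  fixes p e :: "nat \<Rightarrow> 'b :: comm_ring_1"
  assumes newton: "\<And>m. m \<ge> 1 \<Longrightarrow> p m = of_nat m * e m + (\<Sum>i = 1..<m. e i * p (m - i))"
    and "m \<ge> 1"
  shows "p m = (\<Sum>\<beta>\<in>compositions m. of_nat (last \<beta>) * (\<Prod>r\<leftarrow>\<beta>. e r))"
  using \<open>m \<ge> 1\<close>
proof (induction m rule: less_induct)
  case (less m)
  let ?f = "\<lambda>\<beta>. of_nat (last \<beta>) * (\<Prod>r\<leftarrow>\<beta>. e r)"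
  \<comment> \<open>Prepending i preserves the last part only if the tail is nonempty.\<close>
  have ne: "\<gamma> \<noteq> []" if "\<gamma> \<in> compositions k" "k \<ge> 1" for \<gamma> k
    using that by (auto simp: compositions_def)
  have "sum ?f (compositions m) =
      ?f [m] + sum ?f (\<Union>i\<in>{1..<m}. (#) i ` compositions (m - i))"
    unfolding compositions_rec[OF less.prems]
    by (subst sum.insert) (auto simp: finite_compositions dest: ne)
  also have "sum ?f (\<Union>i\<in>{1..<m}. (#) i ` compositions (m - i)) =
      (\<Sum>i = 1..<m. sum ?f ((#) i ` compositions (m - i)))"
    by (rule sum.UNION_disjoint) (auto simp: finite_compositions)
  also have "\<dots> = (\<Sum>i = 1..<m. e i * p (m - i))"
  proof (rule sum.cong)
    fix i assume i: "i \<in> {1..<m}"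
    have "sum ?f ((#) i ` compositions (m - i)) = (\<Sum>\<gamma>\<in>compositions (m - i). e i * ?f \<gamma>)"
    proof (subst sum.reindex)
      show "inj_on ((#) i) (compositions (m - i))" by auto
      show "sum (?f \<circ> (#) i) (compositions (m - i)) = (\<Sum>\<gamma>\<in>compositions (m - i). e i * ?f \<gamma>)"
        by (intro sum.cong) (use ne[of _ "m - i"] i in \<open>force simp: mult_ac\<close>)+
    qed
    also have "\<dots> = e i * p (m - i)"
      using less.IH[of "m - i"] i less_imp_diff_less by (simp add: sum_distrib_left Suc_le_eq)
    finally show "sum ?f ((#) i ` compositions (m - i)) = e i * p (m - i)" .
  qed simp
  finally show ?case
    using newton[OF less.prems] by simp
qed

section \<open>Monomials and truncation\<close>

definition monomial :: "monom \<Rightarrow> pseries" where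
  "monomial a = Series (\<lambda>m. if m = a then 1 else 0)"

lemma coeff_plus [simp]: "coeff (f + g) m = coeff f m + coeff g m"
  by (simp add: plus_pseries_def)

lemma coeff_zero [simp]: "coeff 0 m = 0"
  by (simp add: zero_pseries_def)

lemma coeff_scale [simp]: "coeff (scale c f) m = c * coeff f m"
  by (simp add: scale_def)

lemma coeff_monomial [simp]: "coeff (monomial a) m = (if m = a then 1 else 0)"
  by (simp add: monomial_def)

lemma coeff_times: "coeff (f * g) m = (\<Sum>(a, b) | a + b = m. coeff f a * coeff g b)"
  by (simp add: times_pseries_def)

lemma coeff_sum [simp]: "coeff (\<Sum>i\<in>I. f i) m = (\<Sum>i\<in>I. coeff (f i) m)"
  by (induction I rule: infinite_finite_induct) auto

lemma scale_mult_left: "scale c f * g = scale c (f * g)"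
  by (rule pseries_eqI) (simp add: coeff_times sum_distrib_left case_prod_unfold mult.assoc)

lemma scale_mult_right: "f * scale c g = scale c (f * g)"
  by (metis mult.commute scale_mult_left)

lemma of_nat_mult_eq_scale: "of_nat n * f = scale (of_nat n) f"
  by (induction n) (auto simp: algebra_simps pseries.scale_left_distrib)

lemma monomial_times: "monomial a * monomial b = monomial (a + b)"
proof (rule pseries_eqI)
  fix m
  have "coeff (monomial a * monomial b) m =
      (\<Sum>p\<in>{p. fst p + snd p = m}. if p = (a, b) then 1 else 0)"
    unfolding coeff_times by (intro sum.cong) (auto simp: case_prod_unfold prod_eq_iff)
  also have "\<dots> = coeff (monomial (a + b)) m"
    using finite_splits[of m] by (auto simp: case_prod_unfold)
  finally show "coeff (monomial a * monomial b) m = coeff (monomial (a + b)) m" .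
qed

lemma one_eq_monomial: "1 = monomial {#}"
  by (simp add: one_pseries_def monomial_def)

lemma var_eq_monomial: "var i j = monomial {#(i, j)#}"
  by (simp add: var_def monomial_def)

lemma var_power: "var i j ^ k = monomial (replicate_mset k (i, j))"
  by (induction k) (auto simp: one_eq_monomial var_eq_monomial monomial_times)

lemma prod_var: "finite S \<Longrightarrow> (\<Prod>j\<in>S. var i j) = monomial (image_mset (Pair i) (mset_set S))"
  by (induction S rule: finite_induct) (auto simp: one_eq_monomial var_eq_monomial monomial_times)

text \<open>Equality after setting all variables outside \<open>V\<close> to 0; it carries
  identities in finitely many variables over to series.\<close>

definition agree :: "(nat \<times> nat) set \<Rightarrow> pseries \<Rightarrow> pseries \<Rightarrow> bool" where
  "agree V f g \<longleftrightarrow> (\<forall>m. set_mset m \<subseteq> V \<longrightarrow> coeff f m = coeff g m)"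

text \<open>Factors of a monomial over \<open>V\<close> are again over \<open>V\<close>, so the
  convolution only meets coefficients on which the series agree.\<close>

lemma agree_times: "agree V f f' \<Longrightarrow> agree V g g' \<Longrightarrow> agree V (f * g) (f' * g')"
  unfolding agree_def coeff_times by (auto intro!: sum.cong)

lemma agree_plus: "agree V f f' \<Longrightarrow> agree V g g' \<Longrightarrow> agree V (f + g) (f' + g')"
  by (simp add: agree_def)

lemma agree_sum: "(\<And>i. i \<in> I \<Longrightarrow> agree V (f i) (g i)) \<Longrightarrow> agree V (sum f I) (sum g I)"
  by (simp add: agree_def)

lemma agree_formal_sum:
  assumes "finite B" "B \<subseteq> A"
    and "\<And>a m. a \<in> A - B \<Longrightarrow> set_mset m \<subseteq> V \<Longrightarrow> coeff (f a) m = 0"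
  shows "agree V (formal_sum f A) (sum f B)"
  unfolding agree_def formal_sum_def coeff_Series coeff_sum
proof (intro allI impI)
  fix m assume "set_mset m \<subseteq> V"
  with assms show "(\<Sum>a | a \<in> A \<and> coeff (f a) m \<noteq> 0. coeff (f a) m) = (\<Sum>a\<in>B. coeff (f a) m)"
    by (intro sum.mono_neutral_left) auto
qed

section \<open>Newton's identities in infinitely many variables\<close>

definition power_sum :: "nat \<Rightarrow> nat \<Rightarrow> pseries" where
  "power_sum i m = formal_sum (\<lambda>j. var i j ^ m) {1..}"

definition signed_elem :: "nat \<Rightarrow> nat \<Rightarrow> pseries" where
  "signed_elem i r = (- 1) ^ (r + 1) * elem_sym i r"

text \<open>For j > N the monomial x_ij^m leaves the allowed variables because m is positive; for m
  = 0 every member would be 1.\<close>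

lemma agree_power_sum:
  assumes "m \<ge> 1"
  shows "agree (UNIV \<times> {..N}) (power_sum i m) (\<Sum>j = 1..N. var i j ^ m)"
  unfolding power_sum_def
  by (rule agree_formal_sum) (use assms in \<open>auto simp: var_power split: if_splits\<close>)

lemma agree_signed_elem:
  "agree (UNIV \<times> {..N}) (signed_elem i r) (signed_esym (var i) {1..N} r)"
  unfolding signed_elem_def signed_esym_def elem_sym_def
proof (intro agree_times agree_formal_sum)
  show "{S. S \<subseteq> {1..N} \<and> card S = r} \<subseteq> {S. S \<subseteq> {1..} \<and> finite S \<and> card S = r}"
    by (auto intro: finite_subset)
next
  fix S and m :: monom
  assume S: "S \<in> {S. S \<subseteq> {1..} \<and> finite S \<and> card S = r} - {S. S \<subseteq> {1..N} \<and> card S = r}"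
    and m: "set_mset m \<subseteq> UNIV \<times> {..N}"
  then obtain j where "j \<in> S" "j > N" by (auto simp: subset_eq)
  then have "(i, j) \<in># image_mset (Pair i) (mset_set S)" "(i, j) \<notin># m"
    using S m by auto
  then have "m \<noteq> image_mset (Pair i) (mset_set S)"
    by metis
  then show "coeff (\<Prod>j\<in>S. var i j) m = 0"
    using S by (simp add: prod_var)
qed (auto simp: agree_def)

text \<open>A single coefficient sees only finitely many variables, and there the identity is the
  finite one.\<close>

lemma newton_identity_pseries:
  assumes "m \<ge> 1"
  shows "power_sum k m =
    of_nat m * signed_elem k m + (\<Sum>i = 1..<m. signed_elem k i * power_sum k (m - i))"
    (is "?lhs = ?rhs")
proof (rule pseries_eqI)
  fix a :: monom
  \<comment> \<open>The \<open>0\<close> keeps \<open>Max\<close> meaningful for the empty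
    monomial.\<close>
  define N where "N = Max (insert 0 (snd ` set_mset a))"
  have a: "set_mset a \<subseteq> UNIV \<times> {..N}"
    by (auto simp: N_def intro!: Max_ge image_eqI)
  let ?p = "\<lambda>m. \<Sum>j = 1..N. var k j ^ m" and ?e = "signed_esym (var k) {1..N}"
  have "agree (UNIV \<times> {..N}) ?rhs (of_nat m * ?e m + (\<Sum>i = 1..<m. ?e i * ?p (m - i)))"
    by (intro agree_plus agree_times agree_sum agree_signed_elem agree_power_sum)
       (auto simp: agree_def)
  moreover have "agree (UNIV \<times> {..N}) ?lhs (of_nat m * ?e m + (\<Sum>i = 1..<m. ?e i * ?p (m - i)))"
    using agree_power_sum[OF assms, of N k] newton_identity[OF _ assms, of "{1..N}" "var k"]
    by (simp only: finite_atLeastAtMost)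
  ultimately show "coeff ?lhs a = coeff ?rhs a"
    using a by (simp add: agree_def)
qed

lemma power_sum_eq_sum_compositions:
  "m \<ge> 1 \<Longrightarrow> power_sum k m =
    (\<Sum>\<beta>\<in>compositions m. of_nat (last \<beta>) * (\<Prod>r\<leftarrow>\<beta>. signed_elem k r))"
  by (rule newton_solution) (rule newton_identity_pseries)

section \<open>Least monomials and linear independence\<close>

text \<open>
  Leading terms are replaced by least ones because the variables x_i1 < x_i2 < \<dots> increase
  without bound, so a symmetric series has no greatest monomial.
\<close>

definition least_monom :: "pseries \<Rightarrow> monom \<Rightarrow> bool" where
  "least_monom f a \<longleftrightarrow> coeff f a = 1 \<and> (\<forall>m. coeff f m \<noteq> 0 \<longrightarrow> a \<le> m)"

lemma least_monom_unique: "least_monom f a \<Longrightarrow> least_monom f b \<Longrightarrow> a = b"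
  by (metis antisym least_monom_def zero_neq_one)

lemma least_monom_one: "least_monom 1 {#}"
  by (simp add: least_monom_def one_eq_monomial)

text \<open>The multiset order is compatible with addition, so a + b is least among the sums c + d.
  Equality forces c = a and d = b, so a single product contributes at a + b.\<close>

lemma least_monom_times:
  assumes "least_monom f a" "least_monom g b"
  shows "least_monom (f * g) (a + b)"
proof -
  have le: "a + b \<le> c + d" if "a \<le> c" "b \<le> d" for c d
    using that by (rule add_mono)
  have eq: "c = a \<and> d = b" if "a \<le> c" "b \<le> d" "c + d = a + b" for c d
  proof -
    have "a + b \<le> a + d"
      using that(2) by (rule add_left_mono)
    moreover have "a + d \<le> c + d"
      using that(1) by (rule add_right_mono)
    ultimately have "a + d = a + b"
      using that(3) by (metis antisym)
    with that show ?thesis by simp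
  qed
  have "coeff (f * g) (a + b) = (\<Sum>p\<in>{(a, b)}. coeff f (fst p) * coeff g (snd p))"
    unfolding coeff_times case_prod_unfold
  proof (intro sum.mono_neutral_right ballI)
    show "finite {p. fst p + snd p = a + b}"
      using finite_splits[of "a + b"] by (simp add: case_prod_unfold)
    show "coeff f (fst p) * coeff g (snd p) = 0"
      if "p \<in> {p. fst p + snd p = a + b} - {(a, b)}" for p
      using that eq[of "fst p" "snd p"] assms by (cases p) (auto simp: least_monom_def)
  qed auto
  moreover have "a + b \<le> m" if nz: "coeff (f * g) m \<noteq> 0" for m
  proof -
    obtain c d where "c + d = m" "coeff f c * coeff g d \<noteq> 0"
      using nz unfolding coeff_times by (auto elim!: sum.not_neutral_contains_not_neutral)
    then show ?thesis
      using le assms by (auto simp: least_monom_def)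
  qed
  ultimately show ?thesis
    using assms by (simp add: least_monom_def)
qed

text \<open>The monomials are squarefree and belong to the r-sets S of positive indices. Passing
  from {1..r} to S trades indices up to r for larger ones, which increases the monomial.\<close>

lemma least_monom_elem_sym: "least_monom (elem_sym i r) (image_mset (Pair i) (mset_set {1..r}))"
proof -
  let ?X = "{S. S \<subseteq> {1..} \<and> finite S \<and> card S = r}"
  let ?\<mu> = "\<lambda>S. image_mset (Pair i) (mset_set S)"
  \<comment> \<open>Distinct sets give distinct monomials, so all coefficients are 0 or 1.\<close>
  have inj: "S = S'" if "?\<mu> S = ?\<mu> S'" "finite S" "finite S'" for S S' :: "nat set"
  proof -
    have "set_mset (?\<mu> S) = set_mset (?\<mu> S')"
      using that(1) by (rule arg_cong)
    then show ?thesis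
      using that(2,3) by (auto simp: set_eq_iff image_iff)
  qed
  have coeff: "coeff (elem_sym i r) m = (if m \<in> ?\<mu> ` ?X then 1 else 0)" for m
  proof -
    have "{S \<in> ?X. coeff (\<Prod>j\<in>S. var i j) m \<noteq> 0} = {S \<in> ?X. ?\<mu> S = m}"
      by (auto simp: prod_var split: if_splits)
    then have "coeff (elem_sym i r) m = (\<Sum>S | S \<in> ?X \<and> ?\<mu> S = m. 1)"
      unfolding elem_sym_def formal_sum_def coeff_Series
      by (intro sum.cong) (auto simp: prod_var)
    also have "\<dots> = (if m \<in> ?\<mu> ` ?X then 1 else 0)"
    proof (cases "m \<in> ?\<mu> ` ?X")
      case True
      then obtain S where "S \<in> ?X" "m = ?\<mu> S" by auto
      then have "{S \<in> ?X. ?\<mu> S = m} = {S}" using inj by auto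
      with True show ?thesis by simp
    next
      case False
      then have "{S \<in> ?X. ?\<mu> S = m} = {}" by auto
      then show ?thesis using False by (simp only: sum.empty if_False)
    qed
    finally show ?thesis .
  qed
  have "?\<mu> {1..r} \<le> ?\<mu> S" if "S \<in> ?X" for S
  proof (cases "S = {1..r}")
    case False
    have card: "card S = card {1..r}" "finite S" "finite {1..r}" using that by auto
    then have "S - {1..r} \<noteq> {}"
      using False card_subset_eq[of "{1..r}" S] by auto
    then obtain s where s: "s \<in> S - {1..r}" by blast
    with that have "s > r" by auto
    have split: "mset_set T = mset_set (T \<inter> U) + mset_set (T - U)" if "finite T" for T U :: "nat set"
      using that by (subst mset_set_Union[symmetric]) (auto simp: Int_Diff_Un)
    \<comment> \<open>The common part stays, and the single new index s > r dominates every removed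
      one, as all pairs share the first component i.\<close>
    have "multp (<) (?\<mu> ({1..r} \<inter> S) + ?\<mu> ({1..r} - S)) (?\<mu> ({1..r} \<inter> S) + ?\<mu> (S - {1..r}))"
    proof (rule one_step_implies_multp)
      show "?\<mu> (S - {1..r}) \<noteq> {#}"
        using card s by (auto simp: mset_set_empty_iff)
      show "\<forall>k\<in>#?\<mu> ({1..r} - S). \<exists>j\<in>#?\<mu> (S - {1..r}). k < j"
        using card s \<open>s > r\<close> by (auto intro!: bexI[of _ s])
    qed
    then show ?thesis
      using split[of "{1..r}" S] split[of S "{1..r}"] card
      by (simp add: less_eq_multiset_def less_multiset_def Int_commute)
  qed simp
  moreover have "{1..r} \<in> ?X" by auto
  ultimately show ?thesis
    by (auto simp: least_monom_def coeff split: if_splits)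
qed

text \<open>In a vanishing combination, take a minimal one among the least monomials of the terms
  with nonzero scalar. No other such term contains it, so its coefficient in the sum is that nonzero
  scalar.\<close>

lemma independent_if_distinct_least_monom:
  assumes least: "\<And>t. t \<in> T \<Longrightarrow> least_monom (f t) (l t)" and inj: "inj_on l T"
  shows "pseries.independent (f ` T)" "inj_on f T"
proof -
  show inj_f: "inj_on f T"
    using least least_monom_unique inj by (metis inj_on_def)
  show "pseries.independent (f ` T)"
    unfolding pseries.independent_explicit_finite_subsets
  proof (intro allI impI ballI)
    fix S u v
    assume S: "S \<subseteq> f ` T" "finite S" "(\<Sum>v\<in>S. scale (u v) v) = 0" and v: "v \<in> S"
    obtain T' where T': "T' \<subseteq> T" "S = f ` T'" using S(1) by (meson subset_imageE)
    have fin: "finite T'"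
      using S(2) T' inj_f by (metis finite_imageD inj_on_subset)
    have sum0: "(\<Sum>t\<in>T'. scale (u (f t)) (f t)) = 0"
      using S(3) T' inj_f by (metis (no_types, lifting) inj_on_subset sum.reindex_cong)
    show "u v = 0"
    proof (rule ccontr)
      assume "u v \<noteq> 0"
      let ?L = "l ` {t \<in> T'. u (f t) \<noteq> 0}"
      have "finite ?L" "?L \<noteq> {}"
        using fin v \<open>u v \<noteq> 0\<close> T' by auto
      from finite_has_minimal[OF this] obtain a
        where a: "a \<in> ?L" "\<forall>b\<in>?L. b \<le> a \<longrightarrow> a = b" by (rule bexE)
      then obtain t where t: "t \<in> T'" "u (f t) \<noteq> 0" "a = l t" by auto
      have "u (f s) * coeff (f s) a = (if s = t then u (f t) else 0)" if "s \<in> T'" for s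
      proof (cases "s = t")
        case True
        then show ?thesis
          using t T'(1) least[of t] by (auto simp: least_monom_def)
      next
        case False
        then have "a \<noteq> l s"
          using inj t that T'(1) by (metis inj_onD subsetD)
        \<comment> \<open>By minimality, \<open>l s \<le> a\<close> with a nonzero scalar would mean
          \<open>l s = a\<close>, against injectivity of \<open>l\<close>.\<close>
        then have "u (f s) = 0 \<or> \<not> l s \<le> a"
          using a(2) that by blast
        then show ?thesis
          using False that T'(1) least[of s] by (auto simp: least_monom_def)
      qed
      then have "coeff (\<Sum>s\<in>T'. scale (u (f s)) (f s)) a = (\<Sum>s\<in>T'. if s = t then u (f t) else 0)"
        by simp
      with sum0 t fin show False by simp
    qed
  qed
qed

section \<open>Types as multisets of blocks\<close>

lemma sum_mset_sum: "(\<Sum>p\<in>#(\<Sum>i\<in>A. M i). f p) = (\<Sum>i\<in>A. \<Sum>p\<in>#M i. f p)"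
  for f :: "'a \<Rightarrow> 'b :: comm_monoid_add"
  by (induction A rule: infinite_finite_induct) auto

lemma prod_mset_sum: "(\<Prod>p\<in>#(\<Sum>i\<in>A. M i). f p) = (\<Prod>i\<in>A. \<Prod>p\<in>#M i. f p)"
  for f :: "'a \<Rightarrow> 'b :: comm_monoid_mult"
  by (induction A rule: infinite_finite_induct) auto

lemma sum_blocks: "(\<Sum>(d, r)\<in>#blocks \<tau>. f d r) = (\<Sum>d\<in>support \<tau>. \<Sum>r\<leftarrow>\<tau> d. f d r)"
  for f :: "nat \<Rightarrow> nat \<Rightarrow> 'b :: comm_monoid_add"
  by (simp add: blocks_def sum_mset_sum image_mset.compositionality comp_def flip: sum_mset_sum_list)

lemma prod_blocks: "(\<Prod>(d, r)\<in>#blocks \<tau>. f d r) = (\<Prod>d\<in>support \<tau>. \<Prod>r\<leftarrow>\<tau> d. f d r)"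
  for f :: "nat \<Rightarrow> nat \<Rightarrow> 'b :: comm_monoid_mult"
  by (simp add: blocks_def prod_mset_sum image_mset.compositionality comp_def flip: prod_mset_prod_list)

lemma e_otimes_eq_prod_blocks: "e_otimes \<delta> = (\<Prod>(d, r)\<in>#blocks \<delta>. elem_sym d r)"
  by (simp add: e_otimes_def prod_blocks)

lemma weight_eq_sum_blocks: "weight \<delta> = (\<Sum>(d, r)\<in>#blocks \<delta>. d * r)"
  by (simp add: weight_def sum_blocks sum_list_const_mult)

lemma area_eq_sum_blocks: "area \<delta> = (\<Sum>(d, r)\<in>#blocks \<delta>. r)"
  by (simp add: area_def sum_blocks)

lemma len_eq_size_blocks: "len \<delta> = size (blocks \<delta>)"
  by (simp add: len_def blocks_def size_multiset_sum)

text \<open>Sorting only permutes parts of equal degree; this removes \<open>psort\<close> from the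
  content condition on tabloids.\<close>

lemma blocks_psort: "blocks (psort \<delta>) = blocks \<delta>"
proof -
  have "support (psort \<delta>) = support \<delta>"
    by (auto simp: support_def psort_def) (metis mset_sort mset_zero_iff)+
  then show ?thesis by (simp add: blocks_def psort_def)
qed

lemma count_blocks:
  assumes "finite (support \<tau>)"
  shows "count (blocks \<tau>) (d, r) = count (mset (\<tau> d)) r"
proof -
  have "count (image_mset (Pair i) M) (d, r) = (if i = d then count M r else 0)" for i M
    by (induction M) auto
  then show ?thesis
    using assms by (simp add: blocks_def count_sum support_def)
qed

text \<open>The blocks determine the multiset of parts in each degree, and a weakly decreasing list
  is determined by its multiset.\<close>

lemma type_eq_if_blocks_eq:
  assumes "is_type \<tau>" "is_type \<tau>'" "blocks \<tau> = blocks \<tau>'"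
  shows "\<tau> = \<tau>'"
proof
  fix d
  have "mset (\<tau> d) = mset (\<tau>' d)"
    using assms count_blocks[of \<tau> d] count_blocks[of \<tau>' d]
    by (intro multiset_eqI) (auto simp: is_type_def ordered_type_def)
  moreover have "sorted (rev (\<tau> d))" "sorted (rev (\<tau>' d))"
    using assms by (auto simp: is_type_def is_partition_def sorted_wrt_rev)
  ultimately have "rev (\<tau> d) = rev (\<tau>' d)"
    by (metis mset_rev properties_for_sort)
  then show "\<tau> d = \<tau>' d" by simp
qed

lemma blocks_pos:
  assumes "is_type \<tau>" "(d, r) \<in># blocks \<tau>"
  shows "d \<ge> 1 \<and> r \<ge> 1"
proof -
  have "finite (support \<tau>)" "\<tau> 0 = []" "composition (\<tau> d)"
    using assms by (auto simp: is_type_def ordered_type_def)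
  moreover have "r \<in> set (\<tau> d)"
    using assms(2) count_blocks[OF \<open>finite (support \<tau>)\<close>]
    by (metis count_greater_zero_iff set_mset_mset)
  ultimately show ?thesis
    by (cases d) (auto simp: composition_def Suc_le_eq)
qed

text \<open>Sorting the second components of the blocks with first component d gives \<tau> in
  degree d. Thus every multiset of positive pairs comes from a type, in particular the content of
  any tabloid.\<close>

lemma obtain_type:
  assumes "\<And>d r. (d, r) \<in># M \<Longrightarrow> d \<ge> 1 \<and> r \<ge> 1"
  obtains \<tau> where "is_type \<tau>" "blocks \<tau> = M"
proof -
  define R where "R d = image_mset snd (filter_mset (\<lambda>p. fst p = d) M)" for d
  define \<tau> where "\<tau> d = rev (sorted_list_of_multiset (R d))" for d
  have mset: "mset (\<tau> d) = R d" for d by (simp add: \<tau>_def)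
  have "\<tau> d = [] \<longleftrightarrow> R d = {#}" for d
    by (metis mset mset_zero_iff)
  then have "support \<tau> \<subseteq> fst ` set_mset M"
    by (auto simp: support_def R_def multiset_eq_iff image_iff) (metis fst_conv)
  then have fin: "finite (support \<tau>)"
    by (rule finite_subset) auto
  have pos: "d \<ge> 1 \<and> r \<ge> 1" if "r \<in> set (\<tau> d)" for d r
  proof -
    have "r \<in># R d" using that mset by (metis set_mset_mset)
    then show ?thesis using assms by (auto simp: R_def)
  qed
  have "\<tau> 0 = []"
    using pos[of _ 0] by (cases "\<tau> 0") auto
  moreover have "composition (\<tau> d)" for d
    using pos by (auto simp: composition_def Suc_le_eq)
  moreover have "sorted_wrt (\<ge>) (\<tau> d)" for d
    by (simp add: \<tau>_def sorted_wrt_rev sorted_sorted_list_of_multiset)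
  ultimately have "is_type \<tau>"
    using fin by (simp add: is_type_def ordered_type_def is_partition_def)
  moreover have "blocks \<tau> = M"
  proof (rule multiset_eqI)
    fix p
    have "count (R d) r = count M (d, r)" for d r
      unfolding R_def by (induction M) auto
    then show "count (blocks \<tau>) p = count M p"
      using count_blocks[OF fin] mset by (cases p) simp
  qed
  ultimately show thesis by (rule that)
qed

section \<open>Least monomials of the \<open>e_otimes\<close> and their linear independence\<close>

definition stairs :: "(nat \<times> nat) multiset \<Rightarrow> monom" where
  "stairs M = (\<Sum>(d, r)\<in>#M. image_mset (Pair d) (mset_set {1..r}))"

lemma least_monom_e_otimes: "least_monom (e_otimes \<delta>) (stairs (blocks \<delta>))"
proof -
  have "least_monom (\<Prod>(d, r)\<in>#M. elem_sym d r) (stairs M)" for M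
    by (induction M)
       (auto simp: stairs_def least_monom_one simp del: One_nat_def intro!: least_monom_times least_monom_elem_sym)
  then show ?thesis by (simp add: e_otimes_eq_prod_blocks)
qed

text \<open>For j at least 1 the exponent of x_dj counts the blocks d^r with r at least j (a
  conjugate partition), so consecutive exponents differ by the number of blocks d^j.\<close>

lemma count_stairs:
  assumes "j \<ge> 1"
  shows "count (stairs M) (d, j) = count M (d, j) + count (stairs M) (d, Suc j)"
proof (induction M)
  case (add p M)
  obtain d' r where [simp]: "p = (d', r)" by (cases p)
  have "count (image_mset (Pair d') (mset_set {1..r})) (d, i) =
      (if d' = d \<and> i \<in> {1..r} then 1 else 0)" for i
  proof -
    have "count (image_mset (Pair d') N) (d, i) = (if d' = d then count N i else 0)" for N
      by (induction N) auto
    then show ?thesis by (simp add: count_mset_set')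
  qed
  with add assms show ?case
    by (auto simp: stairs_def)
qed (simp add: stairs_def)

text \<open>Differences of consecutive exponents recover all multiplicities with r at least 1;
  blocks with r = 0 leave no trace in \<open>stairs\<close> and are excluded by assumption.\<close>

lemma stairs_inject:
  assumes "stairs M = stairs N"
    and "\<And>d r. (d, r) \<in># M \<Longrightarrow> r \<ge> 1" and "\<And>d r. (d, r) \<in># N \<Longrightarrow> r \<ge> 1"
  shows "M = N"
proof (rule multiset_eqI)
  fix p :: "nat \<times> nat"
  obtain d r where [simp]: "p = (d, r)" by (cases p)
  show "count M p = count N p"
  proof (cases "r \<ge> 1")
    case True
    then show ?thesis
      using count_stairs[OF True, of _ d] assms(1) by (metis \<open>p = (d, r)\<close> add_right_cancel)
  next
    case False
    then have "p \<notin># M" "p \<notin># N" using assms(2,3) by auto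
    then show ?thesis by (simp add: not_in_iff)
  qed
qed

text \<open>Independence makes \<open>representation\<close> meaningful, and injectivity lets it be
  indexed by types although it looks up basis vectors.\<close>

lemma e_otimes_independent:
  shows "pseries.independent (e_otimes ` types_of n)" and "inj_on e_otimes (types_of n)"
proof -
  have "inj_on (\<lambda>\<tau>. stairs (blocks \<tau>)) (types_of n)"
  proof (rule inj_onI)
    fix \<tau> \<tau>'
    assume "\<tau> \<in> types_of n" "\<tau>' \<in> types_of n"
      and stairs: "stairs (blocks \<tau>) = stairs (blocks \<tau>')"
    then have types: "is_type \<tau>" "is_type \<tau>'" by (auto simp: types_of_def)
    have "blocks \<tau> = blocks \<tau>'"
      using stairs by (rule stairs_inject) (use types blocks_pos in blast)+
    with types show "\<tau> = \<tau>'" by (rule type_eq_if_blocks_eq)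
  qed
  from independent_if_distinct_least_monom[OF least_monom_e_otimes this]
  show "pseries.independent (e_otimes ` types_of n)" "inj_on e_otimes (types_of n)" .
qed

section \<open>Wrappings\<close>

lemma concat_map_eq_map_product:
  "concat (map (\<lambda>x. map (f x) ys) xs) = map (\<lambda>(x, y). f x y) (List.product xs ys)"
  by (induction xs) auto

text \<open>The last part is a disjoint union of \<open>last \<beta>\<close> sheet-columns with k
  boxes each.\<close>

lemma last_size_wrap:
  assumes "k dvd d" "d \<ge> 1" "sum_list \<beta> = d * r div k" "\<beta> \<noteq> []"
  shows "last_size (wrap k d r \<beta>) = k * last \<beta>"
proof -
  define col where "col = (\<lambda>(s, c). {s * k..<(s + 1) * k} \<times> {c :: nat})"
  define ps where "ps = List.product [0..<d div k] [0..<r]"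
  define qs where "qs = take (last \<beta>) (drop (sum_list (butlast \<beta>)) ps)"
  have "k \<ge> 1" using assms by (auto intro: Nat.gr0I simp: Suc_le_eq)
  have cols: "sheet_columns k d r = map col ps"
    by (simp add: sheet_columns_def concat_map_eq_map_product col_def ps_def)
  \<comment> \<open>The parts use up the list of sheet-columns exactly, so the final
    \<open>take\<close> is not cut short.\<close>
  have sum: "sum_list (butlast \<beta>) + last \<beta> = d div k * r"
  proof -
    have "sum_list \<beta> = sum_list (butlast \<beta> @ [last \<beta>])"
      using assms by simp
    then show ?thesis
      using assms by (simp del: append_butlast_last_id add: dvd_div_mult)
  qed
  have "parts (wrap k d r \<beta>) \<noteq> []"
    using assms by (simp add: wrap_def)
  then have "last (parts (wrap k d r \<beta>)) =
      \<Union> (set (take (last \<beta>) (drop (sum_list (butlast \<beta>)) (sheet_columns k d r))))"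
    using assms(4) by (simp add: wrap_def last_map last_conv_nth butlast_conv_take)
  also have "\<dots> = \<Union> (col ` set qs)"
    by (simp add: cols qs_def drop_map take_map)
  finally have part: "last (parts (wrap k d r \<beta>)) = \<Union> (col ` set qs)" .
  have "distinct qs"
    by (simp add: qs_def ps_def distinct_product)
  \<comment> \<open>Row a lies in sheet a div k only.\<close>
  have disj: "col p \<inter> col q = {}" if "p \<noteq> q" for p q
  proof -
    have "s = s'" if "s * k \<le> a" "a < (s + 1) * k" "s' * k \<le> a" "a < (s' + 1) * k" for s s' a
    proof -
      have "a div k = s" "a div k = s'"
        using that by (auto intro!: div_nat_eqI simp: mult.commute)
      then show ?thesis by simp
    qed
    with \<open>p \<noteq> q\<close> show ?thesis
      by (cases p; cases q) (fastforce simp: col_def)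
  qed
  have "card (\<Union> (col ` set qs)) = (\<Sum>q\<in>set qs. card (col q))"
    by (rule card_UN_disjoint) (auto simp: disj, auto simp: col_def)
  also have "\<dots> = (\<Sum>q\<in>set qs. k)"
    by (intro sum.cong) (auto simp: col_def card_cartesian_product)
  also have "\<dots> = k * length qs"
    using \<open>distinct qs\<close> by (simp add: distinct_card)
  also have "length qs = last \<beta>"
    using sum by (simp add: qs_def ps_def)
  finally show ?thesis
    by (simp add: last_size_def part)
qed

lemma blocks_ocon_wrap: "blocks (ocon (wrap k d r \<beta>)) = image_mset (Pair k) (mset \<beta>)"
proof -
  have "support (ocon (wrap k d r \<beta>)) = (if \<beta> = [] then {} else {k})"
    by (auto simp: support_def ocon_def wrap_def)
  then show ?thesis
    by (simp add: blocks_def) (simp add: ocon_def wrap_def)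
qed

lemma wrappings_eq_image:
  "wrappings d r = (\<lambda>(k, \<beta>). wrap k d r \<beta>) ` (SIGMA k:{k. k dvd d}. compositions (d * r div k))"
  by (auto simp: wrappings_def compositions_def)

lemma finite_wrappings: "d \<ge> 1 \<Longrightarrow> finite (wrappings d r)"
  unfolding wrappings_eq_image by (intro finite_imageI finite_SigmaI finite_compositions) auto

text \<open>Since (x^r)^(d/k) = x^(dr/k), each sheet height k contributes k times a power sum.
  Expanding it over compositions, k and the last part combine to \<open>last_size\<close>.\<close>

lemma P_block_eq_sum_wrappings:
  assumes "d \<ge> 1" "r \<ge> 1"
  shows "P_block d r = (\<Sum>B\<in>wrappings d r.
    of_nat (last_size B) * (\<Prod>(i, s)\<in>#blocks (ocon B). signed_elem i s))"
proof -
  define f where "f B = of_nat (last_size B) * (\<Prod>(i, s)\<in>#blocks (ocon B). signed_elem i s)" for B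
  \<comment> \<open>A wrapping records k and \<beta>, so no two index pairs collapse.\<close>
  have "inj_on (\<lambda>(k, \<beta>). wrap k d r \<beta>) X" for X
    by (auto simp: inj_on_def wrap_def)
  then have "sum f (wrappings d r) =
      (\<Sum>(k, \<beta>)\<in>(SIGMA k:{k. k dvd d}. compositions (d * r div k)). f (wrap k d r \<beta>))"
    unfolding wrappings_eq_image by (subst sum.reindex) (auto simp: case_prod_unfold)
  also have "\<dots> = (\<Sum>k | k dvd d. \<Sum>\<beta>\<in>compositions (d * r div k). f (wrap k d r \<beta>))"
    using assms by (subst sum.Sigma) (auto simp: finite_compositions)
  also have "\<dots> = (\<Sum>k | k dvd d. of_nat k * power_sum k (d * r div k))"
  proof (intro sum.cong refl)
    fix k assume "k \<in> {k. k dvd d}"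
    then have k: "k dvd d" by simp
    then have "k \<le> d * r" using assms by (auto dest!: dvd_imp_le intro: le_trans)
    moreover have "k \<ge> 1" using k assms by (auto intro: Nat.gr0I simp: Suc_le_eq)
    ultimately have m: "d * r div k \<ge> 1"
      by (simp add: Suc_le_eq div_greater_zero_iff)
    have "f (wrap k d r \<beta>) = of_nat k * (of_nat (last \<beta>) * (\<Prod>s\<leftarrow>\<beta>. signed_elem k s))"
      if "\<beta> \<in> compositions (d * r div k)" for \<beta>
    proof -
      have "sum_list \<beta> = d * r div k" "\<beta> \<noteq> []"
        using that m by (auto simp: compositions_def)
      then show ?thesis
        unfolding f_def using last_size_wrap[OF k \<open>d \<ge> 1\<close>]
        by (simp add: blocks_ocon_wrap image_mset.compositionality comp_def mult.assoc
            flip: prod_mset_prod_list)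
    qed
    then show "(\<Sum>\<beta>\<in>compositions (d * r div k). f (wrap k d r \<beta>)) =
        of_nat k * power_sum k (d * r div k)"
      by (simp add: power_sum_eq_sum_compositions[OF m] sum_distrib_left)
  qed
  also have "\<dots> = P_block d r"
    unfolding P_block_def P_at_def power_sum_def
    by (intro sum.cong) (auto simp: div_mult_swap mult.commute simp flip: power_mult)
  finally show ?thesis by (simp add: f_def)
qed

section \<open>Expansion of products of power sums\<close>

text \<open>Distributivity, with a list recording the choice in each factor. Repeated entries of
  \<open>bs\<close> are separate factors, so equal blocks choose their wrappings
  independently.\<close>

lemma
  fixes f :: "'a \<Rightarrow> 'b :: comm_semiring_1"
  assumes "\<And>b. b \<in> set bs \<Longrightarrow> finite (A b)"
  shows finite_list_all2: "finite {xs. list_all2 (\<lambda>x b. x \<in> A b) xs bs}"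
    and prod_list_sum: "(\<Prod>b\<leftarrow>bs. \<Sum>x\<in>A b. f x) =
      (\<Sum>xs | list_all2 (\<lambda>x b. x \<in> A b) xs bs. \<Prod>x\<leftarrow>xs. f x)"
proof -
  let ?X = "\<lambda>bs. {xs. list_all2 (\<lambda>x b. x \<in> A b) xs bs}"
  have "finite (?X bs) \<and> (\<Prod>b\<leftarrow>bs. \<Sum>x\<in>A b. f x) = (\<Sum>xs\<in>?X bs. \<Prod>x\<leftarrow>xs. f x)"
    using assms
  proof (induction bs)
    case (Cons b bs)
    have X: "?X (b # bs) = (\<lambda>(x, xs). x # xs) ` (A b \<times> ?X bs)"
      by (auto simp: list_all2_Cons2)
    have fin: "finite (A b)" "finite (?X bs)" using Cons by auto
    have "(\<Sum>xs\<in>?X (b # bs). \<Prod>x\<leftarrow>xs. f x) = (\<Sum>(x, xs)\<in>A b \<times> ?X bs. f x * (\<Prod>x\<leftarrow>xs. f x))"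
      unfolding X by (subst sum.reindex) (auto simp: inj_on_def case_prod_unfold)
    also have "\<dots> = (\<Sum>x\<in>A b. f x) * (\<Sum>xs\<in>?X bs. \<Prod>x\<leftarrow>xs. f x)"
      by (simp add: sum_product sum.cartesian_product)
    finally show ?case
      using Cons fin unfolding X by simp
  qed simp
  then show "finite (?X bs)" "(\<Prod>b\<leftarrow>bs. \<Sum>x\<in>A b. f x) = (\<Sum>xs\<in>?X bs. \<Prod>x\<leftarrow>xs. f x)"
    by auto
qed

text \<open>Each block d^r contributes the sign (-1)^(r-1). The bound
  \<open>size M \<le> ...\<close> is carried through the induction so that subtraction of naturals
  never truncates.\<close>

lemma prod_signed_elem:
  assumes "is_type \<tau>"
  shows "(\<Prod>(d, r)\<in>#blocks \<tau>. signed_elem d r) = scale ((- 1) ^ (area \<tau> - len \<tau>)) (e_otimes \<tau>)"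
proof -
  have "(\<Prod>(d, r)\<in>#M. signed_elem d r) =
      scale ((- 1) ^ ((\<Sum>(d, r)\<in>#M. r) - size M)) (\<Prod>(d, r)\<in>#M. elem_sym d r) \<and>
      size M \<le> (\<Sum>(d, r)\<in>#M. r)"
    if "\<And>d r. (d, r) \<in># M \<Longrightarrow> r \<ge> 1" for M
    using that
  proof (induction M)
    case (add p M)
    obtain d r where [simp]: "p = (d, r)" by (cases p)
    have "r \<ge> 1" using add.prems[of d r] by simp
    then obtain s where [simp]: "r = Suc s" by (cases r) auto
    have sgn: "signed_elem d (Suc s) = scale ((- 1) ^ s) (elem_sym d (Suc s))"
    proof -
      have "(- 1) ^ s * f = scale ((- 1) ^ s) f" for f
        by (induction s) (auto simp: mult.assoc)
      then show ?thesis by (simp add: signed_elem_def)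
    qed
    let ?a = "\<Sum>(d, r)\<in>#M. r"
    have le: "size M \<le> ?a"
      and IH: "(\<Prod>(d, r)\<in>#M. signed_elem d r) =
        scale ((- 1) ^ (?a - size M)) (\<Prod>(d, r)\<in>#M. elem_sym d r)"
      using add by auto
    have "(- 1 :: rat) ^ (s + ?a - size M) = (- 1) ^ s * (- 1) ^ (?a - size M)"
      using le by (simp flip: power_add)
    then show ?case
      using le by (simp add: sgn IH scale_mult_left scale_mult_right mult.commute)
  qed simp
  then show ?thesis
    using blocks_pos[OF assms]
    by (simp add: area_eq_sum_blocks len_eq_size_blocks e_otimes_eq_prod_blocks)
qed

theorem theorem27:
  fixes n :: nat and \<sigma> \<tau> :: otype and bs :: "(nat \<times> nat) list"
  assumes "n \<ge> 1"
    and "is_type \<sigma>" and "weight \<sigma> = n"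
    and "is_type \<tau>" and "weight \<tau> = n"
    and "mset bs = blocks \<sigma>"
  shows "e_coeff n (P_type \<sigma>) \<tau> = (- 1) ^ (area \<tau> - len \<tau>) * (\<Sum>T\<in>tabloids bs \<tau>. of_nat (wt T))"
proof -
  \<comment> \<open>All tabloids of the given shape, of any content; \<open>cont\<close> is the
    content without the sorting.\<close>
  define Ts where "Ts = {T. list_all2 (\<lambda>B (d, r). B \<in> wrappings d r) T bs}"
  define cont where "cont T = (\<Sum>B\<leftarrow>T. blocks (ocon B))" for T
  have pos: "d \<ge> 1 \<and> r \<ge> 1" if "(d, r) \<in> set bs" for d r
    using that blocks_pos[OF assms(2), of d r] assms(6) by (metis set_mset_mset)
  let ?A = "\<lambda>b. case b of (d, r) \<Rightarrow> wrappings d r"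
  let ?f = "\<lambda>B. of_nat (last_size B) * (\<Prod>(i, s)\<in>#blocks (ocon B). signed_elem i s)"
  have Ts: "Ts = {T. list_all2 (\<lambda>B b. B \<in> ?A b) T bs}"
    by (simp add: Ts_def case_prod_unfold)
  have fin_A: "finite (?A b)" if "b \<in> set bs" for b
    using that pos by (cases b rule: prod.exhaust) (auto intro: finite_wrappings)
  have fin: "finite Ts"
    unfolding Ts by (rule finite_list_all2) (rule fin_A)
  have "P_type \<sigma> = (\<Prod>(d, r)\<leftarrow>bs. P_block d r)"
    by (simp add: P_type_def flip: assms(6) prod_mset_prod_list)
  also have "\<dots> = (\<Prod>b\<leftarrow>bs. \<Sum>B\<in>?A b. ?f B)"
    by (intro arg_cong[where f = prod_list] map_cong) (use pos in \<open>auto simp: P_block_eq_sum_wrappings\<close>)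
  also have "\<dots> = (\<Sum>T\<in>Ts. \<Prod>B\<leftarrow>T. ?f B)"
    unfolding Ts by (rule prod_list_sum) (rule fin_A)
  also have "\<dots> = (\<Sum>T\<in>Ts. of_nat (wt T) * (\<Prod>(i, s)\<in>#cont T. signed_elem i s))"
  proof (intro sum.cong refl)
    show "(\<Prod>B\<leftarrow>T. ?f B) = of_nat (wt T) * (\<Prod>(i, s)\<in>#cont T. signed_elem i s)" for T
      by (induction T) (auto simp: wt_def cont_def mult_ac)
  qed
  finally have P: "P_type \<sigma> = (\<Sum>T\<in>Ts. of_nat (wt T) * (\<Prod>(i, s)\<in>#cont T. signed_elem i s))" .
  \<comment> \<open>Every content is a type of n, so the expansion stays within the basis for degree
    n. The weight is preserved because k (dr/k) = dr for each wrapping.\<close>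
  have "\<exists>\<tau>'. \<tau>' \<in> types_of n \<and> blocks \<tau>' = cont T" if "T \<in> Ts" for T
  proof -
    have wrapping: "(\<forall>(i, s)\<in>#blocks (ocon B). i \<ge> 1 \<and> s \<ge> 1) \<and>
        (\<Sum>(i, s)\<in>#blocks (ocon B). i * s) = d * r"
      if "B \<in> wrappings d r" "d \<ge> 1" for B d r
    proof -
      obtain k \<beta> where k: "B = wrap k d r \<beta>" "k dvd d" "composition \<beta>" "sum_list \<beta> = d * r div k"
        using \<open>B \<in> wrappings d r\<close> by (auto simp: wrappings_def)
      have "k \<ge> 1" using k \<open>d \<ge> 1\<close> by (auto intro: Nat.gr0I simp: Suc_le_eq)
      moreover have "(\<Sum>s\<in>#mset \<beta>. k * s) = d * r"
        using k by (simp add: sum_mset_distrib_left[symmetric] sum_mset_sum_list)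
      ultimately show ?thesis
        using k by (auto simp: blocks_ocon_wrap composition_def image_mset.compositionality comp_def Suc_le_eq)
    qed
    have "(\<forall>(i, s)\<in>#cont T. i \<ge> 1 \<and> s \<ge> 1) \<and>
        (\<Sum>(i, s)\<in>#cont T. i * s) = (\<Sum>(d, r)\<leftarrow>bs. d * r)"
      using \<open>T \<in> Ts\<close> pos unfolding Ts_def mem_Collect_eq
    proof (induction T bs rule: list_all2_induct)
      case (Cons B T b bs)
      obtain d r where [simp]: "b = (d, r)" by (cases b)
      have "d \<ge> 1" using Cons.prems[of d r] by simp
      then have "(\<forall>(i, s)\<in>#blocks (ocon B). i \<ge> 1 \<and> s \<ge> 1) \<and>
          (\<Sum>(i, s)\<in>#blocks (ocon B). i * s) = d * r"
        using wrapping[of B d r] Cons.hyps by simp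
      moreover have "(\<forall>(i, s)\<in>#cont T. i \<ge> 1 \<and> s \<ge> 1) \<and>
          (\<Sum>(i, s)\<in>#cont T. i * s) = (\<Sum>(d, r)\<leftarrow>bs. d * r)"
        by (rule Cons.IH) (use Cons.prems in auto)
      moreover have "cont (B # T) = blocks (ocon B) + cont T"
        by (simp add: cont_def)
      ultimately show ?case by auto
    qed (simp add: cont_def)
    then have pos_cont: "\<And>i s. (i, s) \<in># cont T \<Longrightarrow> i \<ge> 1 \<and> s \<ge> 1"
      and weight_cont: "(\<Sum>(i, s)\<in>#cont T. i * s) = (\<Sum>(d, r)\<leftarrow>bs. d * r)"
      by blast+
    have "(\<Sum>(d, r)\<leftarrow>bs. d * r) = n"
      using assms(3) by (simp add: weight_eq_sum_blocks flip: assms(6) sum_mset_sum_list)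
    moreover obtain \<tau>' where "is_type \<tau>'" "blocks \<tau>' = cont T"
      using obtain_type[OF pos_cont] by blast
    ultimately show ?thesis
      using weight_cont by (auto simp: types_of_def weight_eq_sum_blocks)
  qed
  then obtain ty where ty: "\<And>T. T \<in> Ts \<Longrightarrow> ty T \<in> types_of n \<and> blocks (ty T) = cont T"
    by metis
  have \<tau>: "\<tau> \<in> types_of n" using assms by (simp add: types_of_def)
  let ?sgn = "\<lambda>\<tau>. (- 1) ^ (area \<tau> - len \<tau>) :: rat"
  have "P_type \<sigma> = (\<Sum>T\<in>Ts. scale (of_nat (wt T) * ?sgn (ty T)) (e_otimes (ty T)))"
    unfolding P
  proof (intro sum.cong refl)
    fix T assume "T \<in> Ts"
    then have "is_type (ty T)" "blocks (ty T) = cont T" using ty by (auto simp: types_of_def)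
    then show "of_nat (wt T) * (\<Prod>(i, s)\<in>#cont T. signed_elem i s) =
        scale (of_nat (wt T) * ?sgn (ty T)) (e_otimes (ty T))"
      using prod_signed_elem[of "ty T"] by (simp add: of_nat_mult_eq_scale)
  qed
  \<comment> \<open>\<open>representation\<close> is linear on the span, which contains every
    term.\<close>
  then have "e_coeff n (P_type \<sigma>) \<tau> = (\<Sum>T\<in>Ts. of_nat (wt T) * ?sgn (ty T) *
      pseries.representation (e_otimes ` types_of n) (e_otimes (ty T)) (e_otimes \<tau>))"
    using ty e_otimes_independent(1)[of n]
    by (simp add: e_coeff_def pseries.representation_sum pseries.representation_scale
        pseries.span_base pseries.span_scale)
  also have "\<dots> = (\<Sum>T\<in>Ts. of_nat (wt T) * ?sgn (ty T) *
      (if e_otimes \<tau> = e_otimes (ty T) then 1 else 0))"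
    using ty e_otimes_independent(1)[of n]
    by (intro sum.cong) (simp_all add: pseries.representation_basis)
  also have "\<dots> = (\<Sum>T\<in>Ts. if cont T = blocks \<tau> then ?sgn \<tau> * of_nat (wt T) else 0)"
  proof (intro sum.cong refl)
    fix T assume T: "T \<in> Ts"
    \<comment> \<open>The coefficient picks out exactly the tabloids of content \<tau>: basis
      vectors determine types, and types are determined by their blocks.\<close>
    have "e_otimes \<tau> = e_otimes (ty T) \<longleftrightarrow> \<tau> = ty T"
      using inj_on_eq_iff[OF e_otimes_independent(2) \<tau>] ty[OF T] by blast
    moreover have "\<tau> = ty T \<longleftrightarrow> cont T = blocks \<tau>"
      using ty[OF T] assms(4) type_eq_if_blocks_eq[of \<tau> "ty T"]
      unfolding types_of_def by (metis mem_Collect_eq)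
    ultimately show "of_nat (wt T) * ?sgn (ty T) * (if e_otimes \<tau> = e_otimes (ty T) then 1 else 0) =
        (if cont T = blocks \<tau> then ?sgn \<tau> * of_nat (wt T) else 0)"
      by auto
  qed
  also have "\<dots> = (\<Sum>T | T \<in> Ts \<and> cont T = blocks \<tau>. ?sgn \<tau> * of_nat (wt T))"
    using fin by (simp add: sum.inter_filter)
  also have "{T. T \<in> Ts \<and> cont T = blocks \<tau>} = tabloids bs \<tau>"
    by (simp add: Ts_def cont_def tabloids_def blocks_psort)
  finally show ?thesis
    by (simp add: sum_distrib_left)
qed

end
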